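(* A classifier that predicts according to the pick-one-label probabilities has in general a non-zero regret in terms of precision@$k$. That is, there exist integers $m \ge k \ge 1$ and a conditional distribution $\mathbf{P}(\cdot \mid \boldsymbol{x})$ on $\{0,1\}^m$ for some instance $\boldsymbol{x}$ such that the classifier $\boldsymbol{h}$ with $h_j(\boldsymbol{x}) = \eta'_j(\boldsymbol{x})$ for all $j \in \{1,\dots,m\}$, where $$ \eta'_j(\boldsymbol{x}) = \sum_{\boldsymbol{y} \in \{0,1\}^m} \frac{y_j}{\sum_{j'=1}^m y_{j'}} \, \mathbf{P}(\boldsymbol{y} \mid \boldsymbol{x}), $$ satisfies $\mathrm{reg}_{p@k}(\boldsymbol{h} \mid \boldsymbol{x}) > 0$.
   Context: Multi-label classification: given an instance $\boldsymbol{x}$, the label vector $\boldsymbol{y} = (y_1,\dots,y_m) \in \{0,1\}^m$ has conditional distribution $\mathbf{P}(\cdot \mid \boldsymbol{x})$, with marginals $\eta_j(\boldsymbol{x}) = \mathbf{P}(y_j = 1 \mid \boldsymbol{x})$. The values $\eta'_j(\boldsymbol{x})$ are the label probabilities obtained from the pick-one-label heuristic, which replaces $\boldsymbol{y}$ by one of its positive labels chosen uniformly at random; the summand for $\boldsymbol{y} = \boldsymbol{0}$ is taken to be $0$. A classifier $\boldsymbol{h} = (h_1,\dots,h_m)$ predicts for $\boldsymbol{x}$ a set $\hat{\mathcal{Y}}_k$ of $k$ labels with the highest values $h_j(\boldsymbol{x})$. The precision@$k$ loss is $\ell_{p@k} = 1 - \frac1k\sum_{j \in \hat{\mathcal{Y}}_k}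 y_j$, and the corresponding conditional regret (conditional expected loss minus the smallest achievable one) is $$ \mathrm{reg}_{p@k}(\boldsymbol{h} \mid \boldsymbol{x}) = \frac{1}{k}\sum_{i \in \mathcal{Y}_k} \eta_i(\boldsymbol{x}) - \frac{1}{k}\sum_{j \in \hat{\mathcal{Y}}_k} \eta_j(\boldsymbol{x}), $$ where $\mathcal{Y}_k$ is a set of $k$ labels with the highest values $\eta_j(\boldsymbol{x})$. *)

theory Defs
  imports "HOL-Probability.Probability"
begin

text \<open>Labels are \<open>1, \<dots>, m\<close>. A label vector in \<open>{0,1}\<^sup>m\<close> is an extensional function on
  \<open>{1..m}\<close> with values in \<open>{0,1}\<close>, so that distinct functions are distinct vectors. A family of
  conditional distributions is a function \<open>P\<close> from instances to probability mass functions.\<close>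

definition label_vectors :: "nat \<Rightarrow> (nat \<Rightarrow> nat) set" where
  "label_vectors m = ({1..m} \<rightarrow>\<^sub>E {0, 1})"

definition label_distribution :: "nat \<Rightarrow> ('x \<Rightarrow> (nat \<Rightarrow> nat) pmf) \<Rightarrow> bool" where
  "label_distribution m P \<longleftrightarrow> (\<forall>x. set_pmf (P x) \<subseteq> label_vectors m)"

definition marginal :: "('x \<Rightarrow> (nat \<Rightarrow> nat) pmf) \<Rightarrow> 'x \<Rightarrow> nat \<Rightarrow> real" where
  "marginal P x j = measure_pmf.prob (P x) {y. y j = 1}"

text \<open>The summand for the zero vector is \<open>0\<close>, because \<open>0 / 0 = 0\<close>.\<close>

definition pick_one_label :: "nat \<Rightarrow> ('x \<Rightarrow> (nat \<Rightarrow> nat) pmf) \<Rightarrow> 'x \<Rightarrow> nat \<Rightarrow> real" where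
  "pick_one_label m P x j =
     (\<Sum>y\<in>label_vectors m. real (y j) / real (\<Sum>j'=1..m. y j') * pmf (P x) y)"

text \<open>With ties there are several sets of \<open>k\<close> labels with the highest values; the predicate holds
  for each of them.\<close>

definition is_top_k :: "nat \<Rightarrow> nat \<Rightarrow> (nat \<Rightarrow> real) \<Rightarrow> nat set \<Rightarrow> bool" where
  "is_top_k m k v S \<longleftrightarrow>
     S \<subseteq> {1..m} \<and> card S = k \<and> (\<forall>i\<in>S. \<forall>j\<in>{1..m} - S. v j \<le> v i)"

definition precision_loss :: "nat \<Rightarrow> nat set \<Rightarrow> (nat \<Rightarrow> nat) \<Rightarrow> real" where
  "precision_loss k S y = 1 - 1 / real k * (\<Sum>j\<in>S. real (y j))"

definition precision_risk ::
    "nat \<Rightarrow> ('x \<Rightarrow> (nat \<Rightarrow> nat) pmf) \<Rightarrow> 'x \<Rightarrow> nat set \<Rightarrow> real" where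
  "precision_risk k P x S = measure_pmf.expectation (P x) (precision_loss k S)"

text \<open>The regret of predicting the label set \<open>S\<close>. The minimum ranges over all sets of \<open>k\<close> labels,
  each of which is the prediction of some classifier. Lemma \<open>precision_regret_eq\<close> below gives the
  closed form.\<close>

definition precision_regret ::
    "nat \<Rightarrow> nat \<Rightarrow> ('x \<Rightarrow> (nat \<Rightarrow> nat) pmf) \<Rightarrow> 'x \<Rightarrow> nat set \<Rightarrow> real" where
  "precision_regret m k P x S =
     precision_risk k P x S - Min (precision_risk k P x ` {T. T \<subseteq> {1..m} \<and> card T = k})"

lemma is_top_k_exists:
  assumes "k \<le> m"
  shows "\<exists>S. is_top_k m k v S"
  using assms
proof (induction k)
  case 0
  have "is_top_k m 0 v {}" by (simp add: is_top_k_def)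
  then show ?case by blast
next
  case (Suc k)
  then obtain S where S: "is_top_k m k v S" by auto
  have fin: "finite S" using S by (auto simp: is_top_k_def intro: finite_subset)
  have ne: "{1..m} - S \<noteq> {}"
  proof
    assume "{1..m} - S = {}"
    then have "{1..m} \<subseteq> S" by blast
    then have "card {1..m} \<le> card S" using fin by (rule card_mono[rotated])
    then show False using S Suc.prems by (simp add: is_top_k_def)
  qed
  define M where "M = Max (v ` ({1..m} - S))"
  have "M \<in> v ` ({1..m} - S)" unfolding M_def using ne by (intro Max_in) auto
  then obtain i where i: "i \<in> {1..m} - S" "v i = M" by auto
  have "v j \<le> v i" if "j \<in> {1..m} - S" for j
    unfolding i(2) M_def using that by (intro Max_ge) auto
  then have "is_top_k m (Suc k) v (insert i S)"
    using S i(1) fin by (auto simp: is_top_k_def)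
  then show ?case by blast
qed

lemma is_top_k_sum_max:
  assumes Y: "is_top_k m k v Y" and T: "T \<subseteq> {1..m}" "card T = k"
  shows "sum v T \<le> sum v Y"
proof -
  have fin: "finite Y" "finite T"
    using Y T(1) by (auto simp: is_top_k_def intro: finite_subset)
  have "card T = card (T \<inter> Y) + card (T - Y)" "card Y = card (Y \<inter> T) + card (Y - T)"
    using fin by (auto intro: card_Int_Diff)
  then have "card (T - Y) = card (Y - T)"
    using Y T(2) by (simp add: is_top_k_def Int_commute)
  then obtain f where f: "bij_betw f (T - Y) (Y - T)"
    using finite_same_card_bij[of "T - Y" "Y - T"] fin by auto
  have "sum v (T - Y) \<le> (\<Sum>i\<in>T - Y. v (f i))"
  proof (rule sum_mono)
    fix i assume i: "i \<in> T - Y"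
    then have "f i \<in> Y" using f by (auto simp: bij_betw_def)
    then show "v i \<le> v (f i)" using i Y T(1) by (auto simp: is_top_k_def)
  qed
  also have "\<dots> = sum v (Y - T)" by (rule sum.reindex_bij_betw[OF f])
  finally have "sum v (T - Y) \<le> sum v (Y - T)" .
  moreover have "sum v T = sum v (T \<inter> Y) + sum v (T - Y)"
    using fin(2) by (rule sum.Int_Diff)
  moreover have "sum v Y = sum v (T \<inter> Y) + sum v (Y - T)"
    unfolding Int_commute[of T Y] using fin(1) by (rule sum.Int_Diff)
  ultimately show ?thesis by simp
qed

lemma precision_risk_eq:
  assumes P: "label_distribution m P" and S: "S \<subseteq> {1..m}"
  shows "precision_risk k P x S = 1 - 1 / real k * (\<Sum>j\<in>S. marginal P x j)"
proof -
  have supp: "set_pmf (P x) \<subseteq> label_vectors m"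
    using P by (simp add: label_distribution_def)
  have fin: "finite (set_pmf (P x))"
    by (rule finite_subset[OF supp]) (auto simp: label_vectors_def intro: finite_PiE)
  have int: "integrable (measure_pmf (P x)) g" for g :: "(nat \<Rightarrow> nat) \<Rightarrow> real"
    using fin by (rule integrable_measure_pmf_finite)
  have E: "measure_pmf.expectation (P x) (\<lambda>y. real (y j)) = marginal P x j" if "j \<in> S" for j
  proof -
    have "measure_pmf.expectation (P x) (\<lambda>y. real (y j)) =
        measure_pmf.expectation (P x) (indicator {y. y j = 1})"
    proof (rule integral_cong_AE)
      show "AE y in measure_pmf (P x). real (y j) = indicator {y. y j = 1} y"
      proof (rule AE_pmfI)
        fix y assume "y \<in> set_pmf (P x)"
        then have "y \<in> label_vectors m" using supp by blast
        moreover have "j \<in> {1..m}" using that S by blast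
        ultimately have "y j \<in> {0, 1}" unfolding label_vectors_def by (rule PiE_mem)
        then show "real (y j) = indicator {y. y j = 1} y" by (auto simp: indicator_def)
      qed
    qed auto
    then show ?thesis by (simp add: marginal_def)
  qed
  have "precision_risk k P x S =
      1 - 1 / real k * (\<Sum>j\<in>S. measure_pmf.expectation (P x) (\<lambda>y. real (y j)))"
    unfolding precision_risk_def precision_loss_def
    by (subst Bochner_Integration.integral_diff[OF int int],
        subst integral_mult_right_zero,
        subst Bochner_Integration.integral_sum[OF int])
      (simp add: measure_pmf.prob_space)
  also have "(\<Sum>j\<in>S. measure_pmf.expectation (P x) (\<lambda>y. real (y j))) = (\<Sum>j\<in>S. marginal P x j)"
    using E by (rule sum.cong[OF refl])
  finally show ?thesis .
qed

lemma precision_regret_eq: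
  assumes P: "label_distribution m P" and S: "S \<subseteq> {1..m}" "card S = k"
    and Y: "is_top_k m k (marginal P x) Y"
  shows "precision_regret m k P x S =
    1 / real k * (\<Sum>i\<in>Y. marginal P x i) - 1 / real k * (\<Sum>j\<in>S. marginal P x j)"
proof -
  have Y': "Y \<subseteq> {1..m}" "card Y = k" using Y by (auto simp: is_top_k_def)
  have "Min (precision_risk k P x ` {T. T \<subseteq> {1..m} \<and> card T = k}) = precision_risk k P x Y"
  proof (rule Min_eqI)
    show "finite (precision_risk k P x ` {T. T \<subseteq> {1..m} \<and> card T = k})"
      by (rule finite_imageI, rule finite_subset[of _ "Pow {1..m}"]) auto
    show "precision_risk k P x Y \<in> precision_risk k P x ` {T. T \<subseteq> {1..m} \<and> card T = k}"
      using Y' by auto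
  next
    fix r assume "r \<in> precision_risk k P x ` {T. T \<subseteq> {1..m} \<and> card T = k}"
    then obtain T where T: "T \<subseteq> {1..m}" "card T = k" "r = precision_risk k P x T" by auto
    show "precision_risk k P x Y \<le> r"
      using is_top_k_sum_max[OF Y T(1,2)]
      unfolding T(3) precision_risk_eq[OF P T(1)] precision_risk_eq[OF P Y'(1)]
      by (simp add: divide_right_mono)
  qed
  then show ?thesis
    by (simp add: precision_regret_def precision_risk_eq[OF P S(1)] precision_risk_eq[OF P Y'(1)])
qed

end

theory Submission
  imports Defs
begin

text \<open>Three labels and \<open>k = 1\<close> suffice: labels 1 and 2 are jointly positive with probability 3/5, and
  otherwise label 3 alone is positive. Picking one label splits the mass 3/5 evenly between labels 1
  and 2, so label 3 wins with 2/5 against 3/10, although labels 1 and 2 have the larger marginal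
  3/5.\<close>

text \<open>As an expectation, the heuristic can be pulled back along \<open>map_pmf\<close> to the
  Bernoulli variable, instead of summing over all eight vectors.\<close>

lemma pick_one_label_eq_expectation:
  assumes "label_distribution m P"
  shows "pick_one_label m P x j =
    measure_pmf.expectation (P x) (\<lambda>y. real (y j) / real (\<Sum>j'=1..m. y j'))"
proof -
  have "finite (label_vectors m)"
    by (auto simp: label_vectors_def intro: finite_PiE)
  moreover have "set_pmf (P x) \<subseteq> label_vectors m"
    using assms by (simp add: label_distribution_def)
  ultimately have "measure_pmf.expectation (P x) (\<lambda>y. real (y j) / real (\<Sum>j'=1..m. y j')) =
      (\<Sum>y\<in>label_vectors m. pmf (P x) y *\<^sub>R (real (y j) / real (\<Sum>j'=1..m. y j')))"
    by (intro integral_measure_pmf) auto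
  then show ?thesis
    by (simp add: pick_one_label_def mult.commute)
qed

text \<open>A strict maximum rules out ties, so the prediction is forced.\<close>

lemma is_top_1_unique_max:
  assumes "is_top_k m 1 v S" "i \<in> {1..m}" "\<And>j. j \<in> {1..m} \<Longrightarrow> j \<noteq> i \<Longrightarrow> v j < v i"
  shows "S = {i}"
proof -
  obtain s where s: "S = {s}" "s \<in> {1..m}"
    using assms(1) by (auto simp: is_top_k_def card_1_singleton_iff)
  have "s = i"
    using assms s by (force simp: is_top_k_def)
  with s show ?thesis by simp
qed

text \<open>\<open>True\<close> gives the vector (1,1,0) and \<open>False\<close> gives (0,0,1); the
  restriction to \<open>{1..3}\<close> makes them extensional.\<close>

definition pair_or_single :: "bool \<Rightarrow> nat \<Rightarrow> nat" where
  "pair_or_single b = (\<lambda>j\<in>{1..3}. of_bool (b \<longleftrightarrow> j \<noteq> 3))"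

definition pair_or_single_pmf :: "(nat \<Rightarrow> nat) pmf" where
  "pair_or_single_pmf = map_pmf pair_or_single (bernoulli_pmf (3/5))"

lemma label_distribution_pair_or_single:
  "label_distribution 3 (\<lambda>_. pair_or_single_pmf)"
  by (auto simp: label_distribution_def pair_or_single_pmf_def label_vectors_def pair_or_single_def)

lemma marginal_pair_or_single:
  assumes "j \<in> {1..3}"
  shows "marginal (\<lambda>_. pair_or_single_pmf) x j = (if j = 3 then 2/5 else 3/5)"
proof -
  \<comment> \<open>The preimage is one truth value, so the marginal is a Bernoulli point
    mass.\<close>
  have "pair_or_single -` {y. y j = 1} = {j \<noteq> 3}"
    using assms by (auto simp: pair_or_single_def)
  then show ?thesis
    by (simp add: marginal_def pair_or_single_pmf_def measure_pmf_single)
qed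

lemma pick_one_label_pair_or_single:
  assumes "j \<in> {1..3}"
  shows "pick_one_label 3 (\<lambda>_. pair_or_single_pmf) x j = (if j = 3 then 2/5 else 3/10)"
proof -
  \<comment> \<open>The sum is expanded term by term; \<open>sum_of_bool_eq\<close> would turn it
    into a cardinality.\<close>
  have total: "(\<Sum>j'=1..3. pair_or_single b j') = (if b then 2 else 1)" for b
    by (simp add: pair_or_single_def numeral_3_eq_3 del: sum_of_bool_eq)
  show ?thesis
    unfolding pick_one_label_eq_expectation[OF label_distribution_pair_or_single]
    unfolding pair_or_single_pmf_def integral_map_pmf total
    using assms by (simp add: pair_or_single_def)
qed

theorem proposition1:
  "\<exists>(m::nat) (k::nat) (P :: 'x \<Rightarrow> (nat \<Rightarrow> nat) pmf) (x :: 'x).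
     1 \<le> k \<and> k \<le> m \<and> label_distribution m P \<and>
     (\<forall>h :: 'x \<Rightarrow> nat \<Rightarrow> real.
        (\<forall>j\<in>{1..m}. h x j = pick_one_label m P x j) \<longrightarrow>
        (\<forall>Yhat. is_top_k m k (h x) Yhat \<longrightarrow> precision_regret m k P x Yhat > 0))"
proof -
  define P :: "'x \<Rightarrow> (nat \<Rightarrow> nat) pmf" where "P = (\<lambda>_. pair_or_single_pmf)"
  have P: "label_distribution 3 P"
    unfolding P_def by (rule label_distribution_pair_or_single)
  fix x :: 'x
  have "precision_regret 3 1 P x Yhat > 0"
    if h: "\<forall>j\<in>{1..3}. h x j = pick_one_label 3 P x j" and top: "is_top_k 3 1 (h x) Yhat"
    for h :: "'x \<Rightarrow> nat \<Rightarrow> real" and Yhat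
  proof -
    have "Yhat = {3}"
      using top h by (intro is_top_1_unique_max) (auto simp: P_def pick_one_label_pair_or_single)
    \<comment> \<open>Labels 1 and 2 tie for the largest marginal; either serves as the optimum, and
      the regret is 3/5 - 2/5 = 1/5.\<close>
    moreover have "is_top_k 3 1 (marginal P x) {1}"
      by (auto simp: is_top_k_def P_def marginal_pair_or_single)
    ultimately show ?thesis
      using precision_regret_eq[of 3 P "{3}" 1 x "{1}"] P
      by (simp add: P_def marginal_pair_or_single)
  qed
  with P show ?thesis
    by (intro exI[of _ 3] exI[of _ 1] exI[of _ P] exI[of _ x]) auto
qed

end
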